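(* Let $A_1,B_1,C_1\in\mathbb{R}^{n\times n}$ and $A_2,B_2,C_2\in\mathbb{R}^{m\times m}$ be symmetric matrices such that $C_2$ and $C_1\otimes B_2-B_1\otimes C_2$ are positive definite and $C_1$ is negative definite. Let $(i,j)\in\{1,\dots,n\}\times\{1,\dots,m\}$ be the input index of the alternating algorithm and let $(u,v,\lambda,\mu)$ be a fixed point of the alternating algorithm with input index $(i,j)$ (as defined in the context). Then $(\lambda,\mu)$ is the eigenvalue of index $(i,j)$ of the two-parameter eigenvalue problem $$(A_1+\lambda B_1+\mu C_1)u=0,\qquad (A_2+\lambda B_2+\mu C_2)v=0,$$ and $u\otimes v$ is the corresponding eigenvector, i.e. $u,v$ satisfy these two equations.
   Context: Notation: $a_1(u)=u^\top A_1u$, $b_1(u)=u^\top B_1u$, $c_1(u)=u^\top C_1u$, $a_2(v)=v^\top A_2v$, $b_2(v)=v^\top B_2v$, $c_2(v)=v^\top C_2v$. The tensor product $\otimes$ of matrices is the Kronecker product. An eigenvalue of the two-parameter eigenvalue problem is a pair $(\lambda,\mu)$ for which nonzero $u,v$ solving both equations exist; $u\otimes v$ is then called an eigenvector. The eigenvalue has index $(i,j)$ if $0$ is the $i$-th smallest eigenvalue of $A_1+\lambda B_1+\mu C_1$ and the $j$-th smallest eigenvalue of $A_2+\lambda B_2+\mu C_2$ (counted with multiplicity; if $0$ is a multiple eigenvalue, $(\lambda,\mu)$ has several indices). It is a known fact that, under the stated assumptions, there is exactly one eigenvalue of each index $(i,j)\in\{1,\dots,n\}\times\{1,\dots,m\}$.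 The alternating algorithm with input index $(i,j)$ alternately replaces $v$ by an eigenvector for the $j$-th smallest eigenvalue of $$(a_1(u)C_2-c_1(u)A_2)v=\lambda(c_1(u)B_2-b_1(u)C_2)v \quad (\ast)$$ for the current $u$, and $u$ by an eigenvector for the $i$-th smallest eigenvalue of $$(c_2(v)A_1-a_2(v)C_1)u=\lambda(b_2(v)C_1-c_2(v)B_1)u \quad (\ast\ast)$$ for the current $v$; the right-hand side matrices are positive definite under the assumptions, and eigenvalues are ordered and counted with multiplicity. A fixed point of the algorithm with input index $(i,j)$ is a quadruple $(u,v,\lambda,\mu)$ with nonzero $u\in\mathbb{R}^n$, $v\in\mathbb{R}^m$ such that $u$ is an eigenvector of $(\ast\ast)$ (formed with this $v$) for its $i$-th smallest eigenvalue, this eigenvalue being $\lambda$; $v$ is an eigenvector of $(\ast)$ (formed with this $u$) for its $j$-th smallest eigenvalue; and $\mu=-\frac{a_2(v)+\lambda b_2(v)}{c_2(v)}$. *)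

theory Defs
  imports "HOL-Analysis.Analysis"
begin

definition kronecker :: "real^'n^'n \<Rightarrow> real^'m^'m \<Rightarrow> real^('n \<times> 'm)^('n \<times> 'm)"
    (infixl \<open>\<otimes>\<^sub>K\<close> 70) where
  "A \<otimes>\<^sub>K B = (\<chi> p q. A $ fst p $ fst q * B $ snd p $ snd q)"

definition kronecker_vec :: "real^'n \<Rightarrow> real^'m \<Rightarrow> real^('n \<times> 'm)"
    (infixl \<open>\<otimes>\<^sub>V\<close> 70) where
  "u \<otimes>\<^sub>V v = (\<chi> p. u $ fst p * v $ snd p)"

definition quad :: "real^'n^'n \<Rightarrow> real^'n \<Rightarrow> real" where
  "quad M x = x \<bullet> (M *v x)"

definition symmetric :: "real^'n^'n \<Rightarrow> bool" where
  "symmetric M \<longleftrightarrow> transpose M = M"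

text \<open>The two definiteness predicates do not include symmetry. Kronecker products, sums and real
  multiples of symmetric matrices are again symmetric.\<close>

definition positive_definite :: "real^'n^'n \<Rightarrow> bool" where
  "positive_definite M \<longleftrightarrow> (\<forall>x. x \<noteq> 0 \<longrightarrow> quad M x > 0)"

definition negative_definite :: "real^'n^'n \<Rightarrow> bool" where
  "negative_definite M \<longleftrightarrow> (\<forall>x. x \<noteq> 0 \<longrightarrow> quad M x < 0)"

definition gen_eigenvector :: "real^'n^'n \<Rightarrow> real^'n^'n \<Rightarrow> real \<Rightarrow> real^'n \<Rightarrow> bool" where
  "gen_eigenvector M N t x \<longleftrightarrow> x \<noteq> 0 \<and> M *v x = t *\<^sub>R (N *v x)"

text \<open>The multiplicity of \<open>t\<close> is the dimension of the eigenspace. It is used below only for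
  \<open>M\<close> symmetric and \<open>N\<close> symmetric positive definite, where it equals the algebraic multiplicity;
  it is \<open>0\<close> if \<open>t\<close> is not an eigenvalue.\<close>

definition gen_multiplicity :: "real^'n^'n \<Rightarrow> real^'n^'n \<Rightarrow> real \<Rightarrow> nat" where
  "gen_multiplicity M N t = dim {x. M *v x = t *\<^sub>R (N *v x)}"

text \<open>\<open>t\<close> is the \<open>k\<close>-th smallest eigenvalue of \<open>M x = t N x\<close>, \<open>k\<close> being counted from \<open>1\<close>:
  the list \<open>ts\<close> enumerates all eigenvalues in nondecreasing order, each repeated according to its
  multiplicity.\<close>

definition kth_smallest_gen_eigenvalue ::
    "real^'n^'n \<Rightarrow> real^'n^'n \<Rightarrow> nat \<Rightarrow> real \<Rightarrow> bool" where
  "kth_smallest_gen_eigenvalue M N k t \<longleftrightarrow>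
     (\<exists>ts. sorted ts \<and> (\<forall>s. count_list ts s = gen_multiplicity M N s) \<and>
           1 \<le> k \<and> k \<le> length ts \<and> ts ! (k - 1) = t)"

definition kth_smallest_eigenvalue :: "real^'n^'n \<Rightarrow> nat \<Rightarrow> real \<Rightarrow> bool" where
  "kth_smallest_eigenvalue M = kth_smallest_gen_eigenvalue M (mat 1)"

definition tpep_eigenvector ::
    "real^'n^'n \<Rightarrow> real^'n^'n \<Rightarrow> real^'n^'n \<Rightarrow> real^'m^'m \<Rightarrow> real^'m^'m \<Rightarrow> real^'m^'m \<Rightarrow>
     real \<Rightarrow> real \<Rightarrow> real^('n \<times> 'm) \<Rightarrow> bool" where
  "tpep_eigenvector A1 B1 C1 A2 B2 C2 l mu w \<longleftrightarrow>
     (\<exists>u v. u \<noteq> 0 \<and> v \<noteq> 0 \<and>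
            (A1 + l *\<^sub>R B1 + mu *\<^sub>R C1) *v u = 0 \<and>
            (A2 + l *\<^sub>R B2 + mu *\<^sub>R C2) *v v = 0 \<and> w = u \<otimes>\<^sub>V v)"

definition tpep_eigenvalue ::
    "real^'n^'n \<Rightarrow> real^'n^'n \<Rightarrow> real^'n^'n \<Rightarrow> real^'m^'m \<Rightarrow> real^'m^'m \<Rightarrow> real^'m^'m \<Rightarrow>
     real \<Rightarrow> real \<Rightarrow> bool" where
  "tpep_eigenvalue A1 B1 C1 A2 B2 C2 l mu \<longleftrightarrow>
     (\<exists>u v. u \<noteq> 0 \<and> v \<noteq> 0 \<and>
            (A1 + l *\<^sub>R B1 + mu *\<^sub>R C1) *v u = 0 \<and>
            (A2 + l *\<^sub>R B2 + mu *\<^sub>R C2) *v v = 0)"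

definition tpep_eigenvalue_index ::
    "real^'n^'n \<Rightarrow> real^'n^'n \<Rightarrow> real^'n^'n \<Rightarrow> real^'m^'m \<Rightarrow> real^'m^'m \<Rightarrow> real^'m^'m \<Rightarrow>
     nat \<Rightarrow> nat \<Rightarrow> real \<Rightarrow> real \<Rightarrow> bool" where
  "tpep_eigenvalue_index A1 B1 C1 A2 B2 C2 i j l mu \<longleftrightarrow>
     tpep_eigenvalue A1 B1 C1 A2 B2 C2 l mu \<and>
     kth_smallest_eigenvalue (A1 + l *\<^sub>R B1 + mu *\<^sub>R C1) i 0 \<and>
     kth_smallest_eigenvalue (A2 + l *\<^sub>R B2 + mu *\<^sub>R C2) j 0"

text \<open>In a fixed point, the eigenvalue \<open>l'\<close> belonging to \<open>v\<close> is not required to equal the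
  eigenvalue \<open>l\<close> belonging to \<open>u\<close>.\<close>

definition alternating_fixed_point ::
    "real^'n^'n \<Rightarrow> real^'n^'n \<Rightarrow> real^'n^'n \<Rightarrow> real^'m^'m \<Rightarrow> real^'m^'m \<Rightarrow> real^'m^'m \<Rightarrow>
     nat \<Rightarrow> nat \<Rightarrow> real^'n \<Rightarrow> real^'m \<Rightarrow> real \<Rightarrow> real \<Rightarrow> bool" where
  "alternating_fixed_point A1 B1 C1 A2 B2 C2 i j u v l mu \<longleftrightarrow>
     u \<noteq> 0 \<and> v \<noteq> 0 \<and>
     (let M = quad C2 v *\<^sub>R A1 - quad A2 v *\<^sub>R C1;
          N = quad B2 v *\<^sub>R C1 - quad C2 v *\<^sub>R B1
      in kth_smallest_gen_eigenvalue M N i l \<and> gen_eigenvector M N l u) \<and>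
     (let M = quad A1 u *\<^sub>R C2 - quad C1 u *\<^sub>R A2;
          N = quad C1 u *\<^sub>R B2 - quad B1 u *\<^sub>R C2
      in \<exists>l'. kth_smallest_gen_eigenvalue M N j l' \<and> gen_eigenvector M N l' v) \<and>
     mu = - ((quad A2 v + l * quad B2 v) / quad C2 v)"

end

theory Submission
  imports Defs "HOL-Library.Multiset"
begin

text \<open>By a two-sided Courant--Fischer argument, \<open>t\<close> is the \<open>k\<close>-th smallest eigenvalue of
  \<open>M x = t N x\<close> iff \<open>M - t N\<close> is nonpositive on a subspace of dimension at least \<open>k\<close> and
  nonnegative on one of dimension at least \<open>n + 1 - k\<close>. This condition only sees \<open>M - t N\<close>, up to a
  positive factor, and at a fixed point the two pencils evaluated at \<open>l\<close> are positive multiples of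
  \<open>A1 + l B1 + mu C1\<close> and \<open>A2 + l B2 + mu C2\<close>. For uniqueness, the hypotheses give
  \<open>b2 / c2 < b1 / c1\<close> everywhere, so the difference of two points of the \<open>(l, mu)\<close> plane, suitably
  oriented, makes one of the two matrices decrease strictly, and \<open>0\<close> cannot keep its position in
  the spectrum of that matrix.\<close>

section \<open>Quadratic forms and Kronecker products\<close>

lemma inner_symmetric_matrix:
  fixes M :: "real^'n^'n"
  assumes "symmetric M"
  shows "x \<bullet> (M *v y) = y \<bullet> (M *v x)"
  using assms by (metis dot_lmul_matrix inner_commute symmetric_def transpose_matrix_vector)

lemma matrix_vector_mult_scaleR_left: "(c *\<^sub>R M) *v x = c *\<^sub>R (M *v (x :: real^'n))"
  for M :: "real^'n^'m"
  by (rule scaleR_matrix_vector_assoc[symmetric])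

lemma quad_add: "quad (M + N) x = quad M x + quad N x"
  and quad_diff: "quad (M - N) x = quad M x - quad N x"
  and quad_scaleR_matrix: "quad (c *\<^sub>R M) x = c * quad M x"
  by (simp_all add: quad_def matrix_vector_mult_add_rdistrib matrix_vector_mult_diff_rdistrib
      matrix_vector_mult_scaleR_left inner_add_right inner_diff_right)

lemma quad_scaleR: "quad M (c *\<^sub>R x) = c\<^sup>2 * quad M x"
  by (simp add: quad_def matrix_vector_mult_scaleR power2_eq_square)

lemma quad_zero [simp]: "quad M 0 = 0"
  by (simp add: quad_def)

lemma symmetric_add: "symmetric M \<Longrightarrow> symmetric N \<Longrightarrow> symmetric (M + N)"
  and symmetric_diff: "symmetric M \<Longrightarrow> symmetric N \<Longrightarrow> symmetric (M - N)"
  and symmetric_scaleR: "symmetric M \<Longrightarrow> symmetric (c *\<^sub>R M)"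
  by (simp_all add: symmetric_def transpose_def vec_eq_iff)

lemma symmetric_mat: "symmetric (mat c)"
  by (simp add: symmetric_def transpose_mat)

lemma positive_definite_mat_1: "positive_definite (mat 1 :: real^'n^'n)"
  by (simp add: positive_definite_def quad_def)

lemma quad_kronecker_vec:
  fixes A :: "real^'n^'n" and B :: "real^'m^'m"
  shows "quad (A \<otimes>\<^sub>K B) (x \<otimes>\<^sub>V y) = quad A x * quad B y"
proof -
  have "quad (A \<otimes>\<^sub>K B) (x \<otimes>\<^sub>V y) = (\<Sum>p\<in>UNIV \<times> UNIV. \<Sum>q\<in>UNIV \<times> UNIV.
      (x $ fst p * (A $ fst p $ fst q * x $ fst q)) * (y $ snd p * (B $ snd p $ snd q * y $ snd q)))"
    by (simp add: quad_def inner_vec_def matrix_vector_mult_def kronecker_def kronecker_vec_def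
        sum_distrib_left UNIV_Times_UNIV ac_simps)
  also have "\<dots> = (\<Sum>i\<in>UNIV. \<Sum>j\<in>UNIV. \<Sum>k\<in>UNIV. \<Sum>l\<in>UNIV.
      (x $ i * (A $ i $ k * x $ k)) * (y $ j * (B $ j $ l * y $ l)))"
    by (simp only: sum.cartesian_product' fst_conv snd_conv)
  also have "\<dots> = (\<Sum>i\<in>UNIV. \<Sum>k\<in>UNIV. x $ i * (A $ i $ k * x $ k)) *
      (\<Sum>j\<in>UNIV. \<Sum>l\<in>UNIV. y $ j * (B $ j $ l * y $ l))"
    by (simp only: sum_product)
  also have "\<dots> = quad A x * quad B y"
    by (simp add: quad_def inner_vec_def matrix_vector_mult_def sum_distrib_left)
  finally show ?thesis .
qed

lemma kronecker_vec_eq_0_iff: "x \<otimes>\<^sub>V y = 0 \<longleftrightarrow> x = 0 \<or> y = 0"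
  by (auto simp: kronecker_vec_def vec_eq_iff)

text \<open>Definiteness of the Kronecker difference is tested on the nonzero decomposable vector
  \<open>x \<otimes>\<^sub>V y\<close>, where the forms factor. The hypothesis enters the argument
  only through this scalar inequality.\<close>

lemma positive_definite_kronecker_diffD:
  assumes "positive_definite (C1 \<otimes>\<^sub>K B2 - B1 \<otimes>\<^sub>K C2)" "x \<noteq> 0" "y \<noteq> 0"
  shows "quad B1 x * quad C2 y < quad C1 x * quad B2 y"
proof -
  have "quad (C1 \<otimes>\<^sub>K B2 - B1 \<otimes>\<^sub>K C2) (x \<otimes>\<^sub>V y) > 0"
    using assms kronecker_vec_eq_0_iff unfolding positive_definite_def by blast
  then show ?thesis
    by (simp add: quad_diff quad_kronecker_vec)
qed

text \<open>First-order condition at a minimum: \<open>x\<close> minimizes the form on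
  \<open>W\<close>, so the linear coefficient of \<open>s\<close> in \<open>quad D (x + s w)\<close>
  must vanish.\<close>

lemma nonneg_quad_zero_imp_orthogonal:
  fixes D :: "real^'n^'n"
  assumes D: "symmetric D" and W: "subspace W" and nonneg: "\<And>w. w \<in> W \<Longrightarrow> quad D w \<ge> 0"
    and x: "x \<in> W" "quad D x = 0" and w: "w \<in> W"
  shows "w \<bullet> (D *v x) = 0"
proof -
  define a b where "a = quad D w" and "b = w \<bullet> (D *v x)"
  have expand: "quad D (x + s *\<^sub>R w) = 2 * s * b + s\<^sup>2 * a" for s
    using x(2) inner_symmetric_matrix[OF D, of x w]
    by (simp add: quad_def a_def b_def matrix_vector_right_distrib matrix_vector_mult_scaleR
        inner_add_left inner_add_right power2_eq_square algebra_simps)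
  have a: "a \<ge> 0"
    using nonneg w a_def by simp
  \<comment> \<open>The choice s = -b/(a+1) makes the quadratic negative unless b = 0. The minimizer
    -b/a is avoided because a may be 0.\<close>
  have "0 \<le> 2 * (- b / (a + 1)) * b + (- b / (a + 1))\<^sup>2 * a"
    unfolding expand[symmetric] using W x w by (intro nonneg subspace_add subspace_scale)
  also have "\<dots> = - (b\<^sup>2 * (a + 2)) / (a + 1)\<^sup>2"
    using a by (simp add: divide_simps power2_eq_square) (simp add: algebra_simps)
  finally have "b\<^sup>2 * (a + 2) \<le> 0"
    using a by (simp add: divide_simps split: if_splits)
  then have "b\<^sup>2 \<le> 0"
    using a by (simp add: mult_le_0_iff)
  then show ?thesis
    by (simp add: b_def)
qed

section \<open>Simultaneous diagonalization of a symmetric definite pencil\<close>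

locale symmetric_pencil =
  fixes M N :: "real^'n^'n"
  assumes symmetric_M: "symmetric M" and symmetric_N: "symmetric N"
    and posdef_N: "positive_definite N"
begin

lemma quad_N_pos: "x \<noteq> 0 \<Longrightarrow> quad N x > 0"
  using posdef_N by (simp add: positive_definite_def)

text \<open>Let \<open>t\<close> be the minimum of the Rayleigh quotient over the compact unit
  sphere of \<open>W\<close>. By homogeneity \<open>M - t N\<close> is nonnegative on all of
  \<open>W\<close>, and it vanishes at the minimizer, so the first-order condition applies. Since
  \<open>W\<close> need not be invariant, the eigenvalue equation is obtained only when tested
  against \<open>W\<close>.\<close>

lemma rayleigh_minimizer_subspace:
  assumes W: "subspace W" and w0: "w0 \<in> W" "w0 \<noteq> 0"
  obtains x t where "x \<in> W" "x \<noteq> 0" "\<And>w. w \<in> W \<Longrightarrow> w \<bullet> (M *v x) = t * (w \<bullet> (N *v x))"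
proof -
  define K where "K = W \<inter> sphere 0 1"
  have normalize: "(1 / norm w) *\<^sub>R w \<in> K" if "w \<in> W" "w \<noteq> 0" for w
    using that W by (simp add: K_def subspace_scale)
  have "compact K"
    unfolding K_def using W by (simp add: closed_subspace closed_Int_compact)
  moreover have "K \<noteq> {}"
    using normalize w0 by blast
  moreover have "continuous_on K (\<lambda>x. quad M x / quad N x)"
    unfolding quad_def
  proof (intro continuous_intros ballI)
    show "x \<bullet> (N *v x) \<noteq> 0" if "x \<in> K" for x
      using that quad_N_pos[of x] by (force simp: K_def quad_def)
  qed
  ultimately obtain x where x: "x \<in> K" and min: "\<And>w. w \<in> K \<Longrightarrow> quad M x / quad N x \<le> quad M w / quad N w"
    using continuous_attains_inf[of K "\<lambda>x. quad M x / quad N x"] by blast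
  define t where "t = quad M x / quad N x"
  define D where "D = M - t *\<^sub>R N"
  have x': "x \<in> W" "x \<noteq> 0"
    using x by (auto simp: K_def)
  have D: "quad D w \<ge> 0" if "w \<in> W" for w
  proof (cases "w = 0")
    case False
    then have "t \<le> quad M w / quad N w"
      using min[OF normalize[OF that False]] by (simp add: t_def quad_scaleR power2_eq_square)
    then show ?thesis
      using quad_N_pos[OF False] by (simp add: D_def quad_diff quad_scaleR_matrix field_simps)
  qed simp
  have "quad D x = 0"
    using quad_N_pos[OF x'(2)] by (simp add: D_def t_def quad_diff quad_scaleR_matrix)
  then have "w \<bullet> (D *v x) = 0" if "w \<in> W" for w
    using nonneg_quad_zero_imp_orthogonal W D x' that symmetric_M symmetric_N
    by (metis D_def symmetric_diff symmetric_scaleR)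
  then have "w \<bullet> (M *v x) = t * (w \<bullet> (N *v x))" if "w \<in> W" for w
    using that by (simp add: D_def matrix_vector_mult_diff_rdistrib matrix_vector_mult_scaleR_left inner_diff_right)
  with x' show thesis
    using that by blast
qed

definition orthogonal_eigenvectors :: "(real^'n) set \<Rightarrow> bool" where
  "orthogonal_eigenvectors S \<longleftrightarrow> finite S \<and> (\<forall>x\<in>S. \<exists>t. gen_eigenvector M N t x) \<and>
     (\<forall>x\<in>S. \<forall>y\<in>S. x \<noteq> y \<longrightarrow> x \<bullet> (N *v y) = 0)"

lemma inner_sum_orthogonal:
  assumes "orthogonal_eigenvectors S" "y \<in> S"
  shows "y \<bullet> (N *v (\<Sum>x\<in>S. c x *\<^sub>R x)) = c y * quad N y"
proof -
  have "y \<bullet> (N *v (\<Sum>x\<in>S. c x *\<^sub>R x)) = (\<Sum>x\<in>S. c x * (y \<bullet> (N *v x)))"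
    by (simp add: linear_sum[OF matrix_vector_mul_linear] inner_sum_right matrix_vector_mult_scaleR)
  also have "\<dots> = (\<Sum>x\<in>S. if x = y then c y * quad N y else 0)"
    using assms by (intro sum.cong) (auto simp: orthogonal_eigenvectors_def quad_def)
  finally show ?thesis
    using assms by (simp add: orthogonal_eigenvectors_def)
qed

text \<open>The new vector minimizes the Rayleigh quotient on the N-orthogonal complement
  \<open>W\<close> of \<open>S\<close>. Its residual \<open>r\<close> is orthogonal to
  \<open>W\<close> by minimality and to \<open>S\<close> because the elements of \<open>S\<close>
  are eigenvectors. As \<open>W\<close> and \<open>S\<close> together span the space,
  \<open>r = 0\<close>.\<close>

lemma extend_orthogonal_eigenvectors:
  assumes S: "orthogonal_eigenvectors S" and card: "card S < CARD('n)"
  obtains x where "x \<notin> S" "orthogonal_eigenvectors (insert x S)"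
proof -
  define W where "W = {x. \<forall>y\<in>S. y \<bullet> (N *v x) = 0}"
  have W: "subspace W"
    by (simp add: W_def subspace_def matrix_vector_right_distrib matrix_vector_mult_scaleR inner_add_right)
  have "finite S"
    using S by (simp add: orthogonal_eigenvectors_def)
  \<comment> \<open>Fewer than n vectors \<open>N y\<close> leave a nonzero vector orthogonal to all
    of them, hence a nonzero element of \<open>W\<close>.\<close>
  then have "dim (span ((*v) N ` S)) < DIM(real^'n)"
    using card by (simp add: dim_span) (meson card_image_le dim_le_card' finite_imageI le_less_trans)
  then obtain w where w: "w \<noteq> 0" "\<And>y. y \<in> span ((*v) N ` S) \<Longrightarrow> orthogonal w y"
    by (metis orthogonal_to_subspace_exists dim_span)
  have "w \<in> W"
    using w(2)[OF span_base] inner_symmetric_matrix[OF symmetric_N, of _ w]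
    by (simp add: W_def orthogonal_def)
  then obtain x t where x: "x \<in> W" "x \<noteq> 0"
    and xt: "\<And>w. w \<in> W \<Longrightarrow> w \<bullet> (M *v x) = t * (w \<bullet> (N *v x))"
    using rayleigh_minimizer_subspace[OF W] w(1) by blast
  define r where "r = M *v x - t *\<^sub>R (N *v x)"
  have rS: "y \<bullet> r = 0" if "y \<in> S" for y
  proof -
    have "\<exists>s. gen_eigenvector M N s y"
      using S that by (simp add: orthogonal_eigenvectors_def)
    then obtain s where s: "M *v y = s *\<^sub>R (N *v y)"
      by (auto simp: gen_eigenvector_def)
    have "y \<bullet> (M *v x) = s * (y \<bullet> (N *v x))"
      using inner_symmetric_matrix[OF symmetric_M, of y x] inner_symmetric_matrix[OF symmetric_N, of y x] s
      by simp
    then show ?thesis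
      using x(1) that by (simp add: r_def W_def inner_diff_right)
  qed
  have "z \<bullet> r = 0" for z
  proof -
    \<comment> \<open>\<open>p\<close> is the N-orthogonal projection of \<open>z\<close> onto the
      span of \<open>S\<close>, so \<open>z - p\<close> lies in \<open>W\<close>.\<close>
    define p where "p = (\<Sum>y\<in>S. ((y \<bullet> (N *v z)) / quad N y) *\<^sub>R y)"
    have "y \<bullet> (N *v (z - p)) = 0" if "y \<in> S" for y
    proof -
      have "y \<noteq> 0"
        using S that by (auto simp: orthogonal_eigenvectors_def gen_eigenvector_def)
      then show ?thesis
        using inner_sum_orthogonal[OF S that] quad_N_pos[of y]
        by (simp add: p_def matrix_vector_mult_diff_distrib inner_diff_right)
    qed
    then have "(z - p) \<bullet> r = 0"
      using xt[of "z - p"] by (simp add: W_def r_def inner_diff_right)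
    moreover have "p \<bullet> r = 0"
      by (simp add: p_def inner_sum_left rS)
    ultimately show ?thesis
      by (simp add: inner_diff_left)
  qed
  then have "r = 0"
    using inner_eq_zero_iff by blast
  then have "gen_eigenvector M N t x"
    using x by (simp add: gen_eigenvector_def r_def)
  moreover have "x \<bullet> (N *v y) = 0" "y \<bullet> (N *v x) = 0" if "y \<in> S" for y
    using x(1) that inner_symmetric_matrix[OF symmetric_N, of y x] by (simp_all add: W_def)
  moreover have "x \<notin> S"
    using x quad_N_pos[of x] by (auto simp: W_def quad_def)
  ultimately show thesis
    using S that[of x] by (simp add: orthogonal_eigenvectors_def) blast
qed

lemma orthogonal_eigenbasis_exists: "\<exists>S. orthogonal_eigenvectors S \<and> card S = CARD('n)"
proof -
  have "\<exists>S. orthogonal_eigenvectors S \<and> card S = k" if "k \<le> CARD('n)" for k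
    using that
  proof (induction k)
    case 0
    then show ?case
      by (intro exI[of _ "{}"]) (simp add: orthogonal_eigenvectors_def)
  next
    case (Suc k)
    then obtain S where S: "orthogonal_eigenvectors S" "card S = k"
      by auto
    then obtain x where "x \<notin> S" "orthogonal_eigenvectors (insert x S)"
      using Suc.prems extend_orthogonal_eigenvectors by (metis Suc_le_lessD)
    with S show ?case
      by (intro exI[of _ "insert x S"]) (simp add: orthogonal_eigenvectors_def)
  qed
  then show ?thesis
    by simp
qed

end

section \<open>Eigenspaces and signs of the form in an N-orthogonal eigenbasis\<close>

locale pencil_eigenbasis = symmetric_pencil M N for M N :: "real^'n^'n" +
  fixes S :: "(real^'n) set" and e :: "real^'n \<Rightarrow> real"
  assumes orthogonal_S: "orthogonal_eigenvectors S" and card_S: "card S = CARD('n)"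
    and eigenvalue_e: "x \<in> S \<Longrightarrow> M *v x = e x *\<^sub>R (N *v x)"
begin

lemma finite_S: "finite S"
  using orthogonal_S by (simp add: orthogonal_eigenvectors_def)

lemma nonzero_S: "x \<in> S \<Longrightarrow> x \<noteq> 0"
  using orthogonal_S by (auto simp: orthogonal_eigenvectors_def gen_eigenvector_def)

lemma independent_S: "independent S"
proof (rule independent_if_scalars_zero[OF finite_S])
  fix c y
  assume "(\<Sum>x\<in>S. c x *\<^sub>R x) = 0" "y \<in> S"
  then show "c y = 0"
    using inner_sum_orthogonal[OF orthogonal_S, of y c] quad_N_pos[OF nonzero_S, of y] by simp
qed

lemma dim_span_subset: "R \<subseteq> S \<Longrightarrow> dim (span R) = card R"
  using independent_S independent_mono by (metis dim_eq_card_independent dim_span)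

lemma expansion: "z = (\<Sum>x\<in>S. ((x \<bullet> (N *v z)) / quad N x) *\<^sub>R x)"
proof -
  have "z \<in> span S"
    using independent_S card_S
    by (metis DIM_real DIM_cart UNIV_I card_eq_dim dim_UNIV finite_S mult.right_neutral subset_UNIV subset_eq)
  then obtain c where c: "z = (\<Sum>x\<in>S. c x *\<^sub>R x)"
    using finite_S by (auto simp: span_finite)
  have "c x = (x \<bullet> (N *v z)) / quad N x" if "x \<in> S" for x
    using inner_sum_orthogonal[OF orthogonal_S that, of c] quad_N_pos[OF nonzero_S[OF that]] c by simp
  then have "(\<Sum>x\<in>S. c x *\<^sub>R x) = (\<Sum>x\<in>S. ((x \<bullet> (N *v z)) / quad N x) *\<^sub>R x)"
    by simp
  with c show ?thesis by metis
qed

text \<open>By symmetry of \<open>M\<close> and \<open>N\<close>, eigenvectors for distinct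
  eigenvalues are N-orthogonal. The expansion of a vector in the eigenspace of \<open>t\<close>
  therefore involves only basis vectors with \<open>e x = t\<close>.\<close>

lemma eigenspace_eq_span: "{z. M *v z = t *\<^sub>R (N *v z)} = span {x \<in> S. e x = t}"
proof
  show "span {x \<in> S. e x = t} \<subseteq> {z. M *v z = t *\<^sub>R (N *v z)}"
  proof (rule span_minimal)
    show "subspace {z. M *v z = t *\<^sub>R (N *v z)}"
      by (auto simp: subspace_def matrix_vector_right_distrib matrix_vector_mult_scaleR algebra_simps)
  qed (auto simp: eigenvalue_e)
next
  show "{z. M *v z = t *\<^sub>R (N *v z)} \<subseteq> span {x \<in> S. e x = t}"
  proof
    fix z
    assume "z \<in> {z. M *v z = t *\<^sub>R (N *v z)}"
    then have z: "M *v z = t *\<^sub>R (N *v z)" by simp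
    have "((x \<bullet> (N *v z)) / quad N x) *\<^sub>R x \<in> span {x \<in> S. e x = t}" if x: "x \<in> S" for x
    proof (cases "e x = t")
      case True
      with x show ?thesis by (simp add: span_base span_scale)
    next
      case False
      have "x \<bullet> (M *v z) = z \<bullet> (M *v x)"
        by (rule inner_symmetric_matrix[OF symmetric_M])
      then have "t * (x \<bullet> (N *v z)) = e x * (x \<bullet> (N *v z))"
        using z eigenvalue_e[OF x] inner_symmetric_matrix[OF symmetric_N, of x z] by simp
      with False have "x \<bullet> (N *v z) = 0" by simp
      then show ?thesis by (simp add: span_zero)
    qed
    then show "z \<in> span {x \<in> S. e x = t}"
      using expansion[of z] by (metis (no_types, lifting) span_sum)
  qed
qed

lemma gen_multiplicity_eq_card: "gen_multiplicity M N t = card {x \<in> S. e x = t}"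
  unfolding gen_multiplicity_def eigenspace_eq_span by (rule dim_span_subset) auto

text \<open>The eigenbasis diagonalizes \<open>M - t N\<close>. The expansion of \<open>z\<close> is
  returned with the same coefficients because the strict sign lemmas need a nonzero one.\<close>

lemma quad_on_span:
  assumes R: "R \<subseteq> S" and z: "z \<in> span R"
  obtains c where "z = (\<Sum>x\<in>R. c x *\<^sub>R x)"
    "quad (M - t *\<^sub>R N) z = (\<Sum>x\<in>R. (c x)\<^sup>2 * (e x - t) * quad N x)"
proof -
  have fin: "finite R" using R finite_S finite_subset by blast
  have orth: "orthogonal_eigenvectors R"
    using R fin orthogonal_S unfolding orthogonal_eigenvectors_def by blast
  obtain c where c: "z = (\<Sum>x\<in>R. c x *\<^sub>R x)"
    using z fin by (auto simp: span_finite)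
  have "(M - t *\<^sub>R N) *v z = (\<Sum>x\<in>R. (c x * (e x - t)) *\<^sub>R (N *v x))"
    unfolding c linear_sum[OF matrix_vector_mul_linear]
  proof (rule sum.cong)
    fix x assume "x \<in> R"
    then have "M *v x = e x *\<^sub>R (N *v x)" using R eigenvalue_e by blast
    then show "(M - t *\<^sub>R N) *v (c x *\<^sub>R x) = (c x * (e x - t)) *\<^sub>R (N *v x)"
      by (simp add: matrix_vector_mult_diff_rdistrib matrix_vector_mult_scaleR_left
          matrix_vector_mult_scaleR algebra_simps)
  qed simp
  then have "quad (M - t *\<^sub>R N) z = (\<Sum>x\<in>R. (c x * (e x - t)) * (z \<bullet> (N *v x)))"
    by (simp add: quad_def inner_sum_right)
  also have "\<dots> = (\<Sum>x\<in>R. (c x)\<^sup>2 * (e x - t) * quad N x)"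
  proof (rule sum.cong)
    fix x assume "x \<in> R"
    then have "z \<bullet> (N *v x) = c x * quad N x"
      using inner_sum_orthogonal[OF orth, of x c] inner_symmetric_matrix[OF symmetric_N, of z x] c by simp
    then show "(c x * (e x - t)) * (z \<bullet> (N *v x)) = (c x)\<^sup>2 * (e x - t) * quad N x"
      by (simp add: power2_eq_square)
  qed simp
  finally show thesis using c that by blast
qed

lemma quad_span_le:
  assumes z: "z \<in> span {x \<in> S. e x \<le> t}"
  shows "quad (M - t *\<^sub>R N) z \<le> 0"
proof -
  obtain c where c: "quad (M - t *\<^sub>R N) z = (\<Sum>x\<in>{x \<in> S. e x \<le> t}. (c x)\<^sup>2 * (e x - t) * quad N x)"
    using quad_on_span[OF _ z] by auto
  show ?thesis unfolding c
    by (rule sum_nonpos) (auto simp: mult_le_0_iff less_imp_le quad_N_pos nonzero_S)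
qed

lemma quad_span_ge:
  assumes z: "z \<in> span {x \<in> S. e x \<ge> t}"
  shows "quad (M - t *\<^sub>R N) z \<ge> 0"
proof -
  obtain c where c: "quad (M - t *\<^sub>R N) z = (\<Sum>x\<in>{x \<in> S. e x \<ge> t}. (c x)\<^sup>2 * (e x - t) * quad N x)"
    using quad_on_span[OF _ z] by auto
  show ?thesis unfolding c
    by (rule sum_nonneg) (auto simp: less_imp_le quad_N_pos nonzero_S)
qed

lemma quad_span_less:
  assumes z: "z \<in> span {x \<in> S. e x < t}" "z \<noteq> 0"
  shows "quad (M - t *\<^sub>R N) z < 0"
proof -
  obtain c where c: "z = (\<Sum>x\<in>{x \<in> S. e x < t}. c x *\<^sub>R x)"
    "quad (M - t *\<^sub>R N) z = (\<Sum>x\<in>{x \<in> S. e x < t}. (c x)\<^sup>2 * (e x - t) * quad N x)"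
    using quad_on_span[OF _ z(1)] by auto
  \<comment> \<open>A nonzero \<open>z\<close> has a nonzero coefficient; its term makes the sum
    strictly negative.\<close>
  obtain x0 where x0: "x0 \<in> S" "e x0 < t" "c x0 \<noteq> 0"
    using z(2) c(1) by (metis (mono_tags, lifting) mem_Collect_eq scale_eq_0_iff sum.neutral)
  have "(\<Sum>x\<in>{x \<in> S. e x < t}. (c x)\<^sup>2 * (t - e x) * quad N x) > 0"
    using x0 finite_S
    by (intro sum_pos2[of _ x0]) (auto simp: less_imp_le quad_N_pos nonzero_S)
  moreover have "(\<Sum>x\<in>{x \<in> S. e x < t}. (c x)\<^sup>2 * (t - e x) * quad N x) = - quad (M - t *\<^sub>R N) z"
    unfolding c(2) sum_negf[symmetric] by (rule sum.cong) (auto simp: algebra_simps)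
  ultimately show ?thesis by simp
qed

lemma quad_span_greater:
  assumes z: "z \<in> span {x \<in> S. e x > t}" "z \<noteq> 0"
  shows "quad (M - t *\<^sub>R N) z > 0"
proof -
  obtain c where c: "z = (\<Sum>x\<in>{x \<in> S. e x > t}. c x *\<^sub>R x)"
    "quad (M - t *\<^sub>R N) z = (\<Sum>x\<in>{x \<in> S. e x > t}. (c x)\<^sup>2 * (e x - t) * quad N x)"
    using quad_on_span[OF _ z(1)] by auto
  obtain x0 where x0: "x0 \<in> S" "e x0 > t" "c x0 \<noteq> 0"
    using z(2) c(1) by (metis (mono_tags, lifting) mem_Collect_eq scale_eq_0_iff sum.neutral)
  show ?thesis unfolding c(2)
    using x0 finite_S
    by (intro sum_pos2[of _ x0]) (auto simp: less_imp_le quad_N_pos nonzero_S)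
qed

end

section \<open>Counting eigenvalues with multiplicity\<close>

text \<open>In a sorted list the entries below \<open>t\<close> form an initial segment, and the
  copies of \<open>t\<close> come right after it. Counted from 1, the copies occupy exactly the
  positions after the number of entries below \<open>t\<close>, up to the number of entries at most
  \<open>t\<close>.\<close>

lemma sorted_nth_eq_iff:
  fixes ts :: "'a::linorder list"
  assumes "sorted ts"
  shows "1 \<le> k \<and> k \<le> length ts \<and> ts ! (k - 1) = t \<longleftrightarrow>
    length (filter (\<lambda>s. s < t) ts) < k \<and> k \<le> length (filter (\<lambda>s. s \<le> t) ts)"
proof -
  let ?L = "{i. i < length ts \<and> ts ! i < t}" and ?LE = "{i. i < length ts \<and> ts ! i \<le> t}"
  have mono: "ts ! i \<le> ts ! j" if "i \<le> j" "j < length ts" for i j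
    using assms that by (simp add: sorted_nth_mono)
  have "card ?L < k \<and> k \<le> card ?LE" if k: "1 \<le> k" "k \<le> length ts" and t: "ts ! (k - 1) = t"
  proof -
    have "?L \<subseteq> {..<k - 1}"
      using mono[of "k - 1"] t by (force simp: not_le[symmetric])
    then have "card ?L \<le> k - 1"
      using card_mono[of "{..<k - 1}" ?L] by simp
    moreover have "{..<k} \<subseteq> ?LE"
      using mono[of _ "k - 1"] k t by auto
    then have "k \<le> card ?LE"
      using card_mono[of ?LE "{..<k}"] by simp
    ultimately show ?thesis using k by simp
  qed
  moreover have "1 \<le> k \<and> k \<le> length ts \<and> ts ! (k - 1) = t" if L: "card ?L < k" and LE: "k \<le> card ?LE"
  proof -
    have "card ?LE \<le> length ts"
      using card_mono[of "{..<length ts}" ?LE] by auto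
    then have k: "1 \<le> k" "k \<le> length ts" using L LE by auto
    have "\<not> ts ! (k - 1) < t"
    proof
      assume "ts ! (k - 1) < t"
      moreover have "ts ! i \<le> ts ! (k - 1)" if "i < k" for i
        using mono[of i "k - 1"] k that by simp
      ultimately have "{..<k} \<subseteq> ?L"
        using k by (auto intro: le_less_trans)
      then have "k \<le> card ?L"
        using card_mono[of ?L "{..<k}"] by simp
      with L show False by simp
    qed
    moreover have "\<not> ts ! (k - 1) > t"
    proof
      assume "ts ! (k - 1) > t"
      then have "i < k - 1" if "i < length ts" "ts ! i \<le> t" for i
        using mono[of "k - 1" i] that by (meson leD le_less_trans not_le_imp_less order_trans)
      then have "?LE \<subseteq> {..<k - 1}"
        by auto
      then have "card ?LE \<le> k - 1"
        using card_mono[of "{..<k - 1}" ?LE] by simp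
      with LE k show False by simp
    qed
    ultimately show ?thesis using k by simp
  qed
  ultimately show ?thesis unfolding length_filter_conv_card by blast
qed

context pencil_eigenbasis
begin

text \<open>The multiplicity condition fixes the multiset of \<open>ts\<close> as the image of the
  eigenbasis under \<open>e\<close>, so the lengths of filtered lists become cardinalities of
  subsets of \<open>S\<close>.\<close>

lemma kth_smallest_iff_card:
  "kth_smallest_gen_eigenvalue M N k t \<longleftrightarrow> card {x \<in> S. e x < t} < k \<and> k \<le> card {x \<in> S. e x \<le> t}"
proof -
  have mult: "(\<forall>s. count_list ts s = gen_multiplicity M N s) \<longleftrightarrow> mset ts = image_mset e (mset_set S)" for ts
  proof -
    have "count (image_mset e (mset_set S)) s = gen_multiplicity M N s" for s
      using finite_S by (simp add: count_image_mset gen_multiplicity_eq_card Int_def vimage_def conj_commute)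
    then show ?thesis
      by (simp add: multiset_eq_iff count_mset)
  qed
  have filter: "length (filter P ts) = card {x \<in> S. P (e x)}"
    if "mset ts = image_mset e (mset_set S)" for ts P
  proof -
    have "length (filter P ts) = size (filter_mset P (image_mset e (mset_set S)))"
      by (metis mset_filter size_mset that)
    then show ?thesis
      using finite_S by (simp add: filter_mset_image_mset filter_mset_mset_set)
  qed
  \<comment> \<open>Existence of the enumeration is needed for the direction from cardinalities back
    to the list.\<close>
  have "\<exists>ts. sorted ts \<and> mset ts = image_mset e (mset_set S)"
    by (metis mset_sorted_list_of_multiset sorted_sorted_list_of_multiset)
  then show ?thesis
    unfolding kth_smallest_gen_eigenvalue_def mult
    using sorted_nth_eq_iff[of _ k t] filter by fastforce
qed

end

section \<open>Position of an eigenvalue as a signature condition\<close>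

text \<open>\<open>0\<close> is the \<open>k\<close>-th smallest eigenvalue of \<open>D\<close>, expressed through the signature of \<open>D\<close>.\<close>

definition zero_in_position :: "real^'n^'n \<Rightarrow> nat \<Rightarrow> bool" where
  "zero_in_position D k \<longleftrightarrow>
     (\<exists>P. subspace P \<and> k \<le> dim P \<and> (\<forall>x\<in>P. quad D x \<le> 0)) \<and>
     (\<exists>Q. subspace Q \<and> CARD('n) < dim Q + k \<and> (\<forall>x\<in>Q. quad D x \<ge> 0))"

lemma dim_le_if_Int_trivial:
  fixes P Q :: "(real^'n) set"
  assumes "subspace P" "subspace Q" "P \<inter> Q \<subseteq> {0}"
  shows "dim P + dim Q \<le> CARD('n)"
proof -
  have "P \<inter> Q = {0}"
    using assms subspace_0 by blast
  moreover have "dim {x + y |x y. x \<in> P \<and> y \<in> Q} \<le> CARD('n)"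
    using dim_subset_UNIV[of "{x + y |x y. x \<in> P \<and> y \<in> Q}"] by simp
  ultimately show ?thesis
    using dim_sums_Int[OF assms(1,2)] by simp
qed

text \<open>The spans of the eigenvectors with eigenvalue at most \<open>t\<close> and at least
  \<open>t\<close> serve as witnesses. Conversely, an arbitrary \<open>P\<close> meets the span for
  eigenvalues above \<open>t\<close> trivially, and \<open>Q\<close> the span for those below
  \<open>t\<close>, so the dimension formula bounds both counts.\<close>

lemma (in symmetric_pencil) kth_smallest_iff_zero_in_position:
  "kth_smallest_gen_eigenvalue M N k t \<longleftrightarrow> zero_in_position (M - t *\<^sub>R N) k"
proof -
  obtain S where S: "orthogonal_eigenvectors S" "card S = CARD('n)"
    using orthogonal_eigenbasis_exists by blast
  then have "\<forall>x\<in>S. \<exists>s. M *v x = s *\<^sub>R (N *v x)"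
    by (auto simp: orthogonal_eigenvectors_def gen_eigenvector_def)
  then obtain e where "\<forall>x\<in>S. M *v x = e x *\<^sub>R (N *v x)"
    by metis
  with S interpret pencil_eigenbasis M N S e
    by unfold_locales auto
  have split_less: "card {x \<in> S. e x < t} + card {x \<in> S. e x \<ge> t} = CARD('n)"
    and split_greater: "card {x \<in> S. e x \<le> t} + card {x \<in> S. e x > t} = CARD('n)"
    unfolding card_S[symmetric]
    using finite_S by (subst card_Un_disjoint[symmetric]; force intro: arg_cong[of _ _ card])+
  have dims: "dim (span {x \<in> S. p (e x)}) = card {x \<in> S. p (e x)}" for p
    by (rule dim_span_subset) auto
  show ?thesis
  proof
    assume "kth_smallest_gen_eigenvalue M N k t"
    then have k: "card {x \<in> S. e x < t} < k" "k \<le> card {x \<in> S. e x \<le> t}"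
      by (auto simp: kth_smallest_iff_card)
    show "zero_in_position (M - t *\<^sub>R N) k"
      unfolding zero_in_position_def
    proof
      show "\<exists>P. subspace P \<and> k \<le> dim P \<and> (\<forall>x\<in>P. quad (M - t *\<^sub>R N) x \<le> 0)"
        using k(2) dims[of "\<lambda>s. s \<le> t"] quad_span_le
        by (intro exI[of _ "span {x \<in> S. e x \<le> t}"]) auto
      show "\<exists>Q. subspace Q \<and> CARD('n) < dim Q + k \<and> (\<forall>x\<in>Q. quad (M - t *\<^sub>R N) x \<ge> 0)"
        using k(1) split_less dims[of "\<lambda>s. s \<ge> t"] quad_span_ge
        by (intro exI[of _ "span {x \<in> S. e x \<ge> t}"]) auto
    qed
  next
    assume "zero_in_position (M - t *\<^sub>R N) k"
    then obtain P Q where P: "subspace P" "k \<le> dim P" "\<And>x. x \<in> P \<Longrightarrow> quad (M - t *\<^sub>R N) x \<le> 0"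
      and Q: "subspace Q" "CARD('n) < dim Q + k" "\<And>x. x \<in> Q \<Longrightarrow> quad (M - t *\<^sub>R N) x \<ge> 0"
      unfolding zero_in_position_def by blast
    have "dim P + card {x \<in> S. e x > t} \<le> CARD('n)"
      unfolding dims[of "\<lambda>s. s > t", symmetric]
      using P quad_span_greater by (intro dim_le_if_Int_trivial) (auto simp: not_le[symmetric])
    moreover have "dim Q + card {x \<in> S. e x < t} \<le> CARD('n)"
      unfolding dims[of "\<lambda>s. s < t", symmetric]
      using Q quad_span_less by (intro dim_le_if_Int_trivial) (auto simp: not_le[symmetric])
    ultimately show "kth_smallest_gen_eigenvalue M N k t"
      using P(2) Q(2) split_greater by (simp add: kth_smallest_iff_card)
  qed
qed

text \<open>Ordinary eigenvalues are the case of the identity as right-hand matrix, taken at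
  \<open>t = 0\<close>.\<close>

lemma kth_smallest_eigenvalue_zero_iff:
  "symmetric D \<Longrightarrow> kth_smallest_eigenvalue D k 0 \<longleftrightarrow> zero_in_position D k"
  using symmetric_pencil.kth_smallest_iff_zero_in_position[of D "mat 1" k 0]
  by (simp add: kth_smallest_eigenvalue_def symmetric_pencil_def symmetric_mat positive_definite_mat_1)

lemma zero_in_position_scaleR:
  "c > 0 \<Longrightarrow> zero_in_position (c *\<^sub>R D) k \<longleftrightarrow> zero_in_position D k"
  by (simp add: zero_in_position_def quad_scaleR_matrix mult_le_0_iff zero_le_mult_iff)

section \<open>Uniqueness of the eigenvalue of a given index\<close>

text \<open>On the nonpositive subspace \<open>P\<close> of \<open>D\<close> the perturbed form is
  strictly negative away from 0, so \<open>P\<close> meets the nonnegative subspace \<open>Q\<close>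
  of \<open>D + E\<close> trivially. But their dimensions add up to more than n.\<close>

lemma zero_not_in_same_position:
  fixes D E :: "real^'n^'n"
  assumes "negative_definite E" "zero_in_position D k"
  shows "\<not> zero_in_position (D + E) k"
proof
  assume "zero_in_position (D + E) k"
  then obtain Q where Q: "subspace Q" "CARD('n) < dim Q + k" "\<And>x. x \<in> Q \<Longrightarrow> quad (D + E) x \<ge> 0"
    unfolding zero_in_position_def by blast
  obtain P where P: "subspace P" "k \<le> dim P" "\<And>x. x \<in> P \<Longrightarrow> quad D x \<le> 0"
    using assms(2) unfolding zero_in_position_def by blast
  have "quad (D + E) x < 0" if "x \<in> P" "x \<noteq> 0" for x
    using P(3)[OF that(1)] assms(1) that(2) by (fastforce simp: quad_add negative_definite_def)
  then have "dim P + dim Q \<le> CARD('n)"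
    using P(1) Q by (intro dim_le_if_Int_trivial) (auto simp: not_le[symmetric])
  with P(2) Q(2) show False by simp
qed

lemma tpep_index_unique:
  fixes A1 B1 C1 :: "real^'n^'n" and A2 B2 C2 :: "real^'m^'m"
  assumes C2: "positive_definite C2" and C1: "negative_definite C1"
    and delta: "positive_definite (C1 \<otimes>\<^sub>K B2 - B1 \<otimes>\<^sub>K C2)"
    and pos: "zero_in_position (A1 + l *\<^sub>R B1 + mu *\<^sub>R C1) i" "zero_in_position (A2 + l *\<^sub>R B2 + mu *\<^sub>R C2) j"
    and pos': "zero_in_position (A1 + l' *\<^sub>R B1 + mu' *\<^sub>R C1) i" "zero_in_position (A2 + l' *\<^sub>R B2 + mu' *\<^sub>R C2) j"
  shows "l' = l \<and> mu' = mu"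
proof -
  \<comment> \<open>Both points keep 0 in position \<open>k\<close>, so passing from one to the
    other cannot lower the matrix strictly.\<close>
  have no_descent: "\<not> negative_definite ((q - p) *\<^sub>R B + (q' - p') *\<^sub>R C)"
    if "zero_in_position (A + p *\<^sub>R B + p' *\<^sub>R C) k" "zero_in_position (A + q *\<^sub>R B + q' *\<^sub>R C) k"
    for A B C :: "real^'d^'d" and p p' q q' k
  proof -
    have "A + q *\<^sub>R B + q' *\<^sub>R C = (A + p *\<^sub>R B + p' *\<^sub>R C) + ((q - p) *\<^sub>R B + (q' - p') *\<^sub>R C)"
      by (simp add: algebra_simps)
    with that show ?thesis
      using zero_not_in_same_position by metis
  qed
  have not_less: "\<not> p < q"
    if p: "zero_in_position (A1 + p *\<^sub>R B1 + p' *\<^sub>R C1) i" "zero_in_position (A2 + p *\<^sub>R B2 + p' *\<^sub>R C2) j"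
      and q: "zero_in_position (A1 + q *\<^sub>R B1 + q' *\<^sub>R C1) i" "zero_in_position (A2 + q *\<^sub>R B2 + q' *\<^sub>R C2) j"
    for p p' q q'
  proof
    assume "p < q"
    define d where "d = q - p"
    define f where "f = q' - p'"
    have d: "d > 0" using \<open>p < q\<close> by (simp add: d_def)
    \<comment> \<open>The first matrix does not decrease strictly, so some direction
      \<open>x\<close> witnesses this. Against this fixed \<open>x\<close>, the second matrix is
      shown to decrease in every direction \<open>y\<close>.\<close>
    obtain x where x: "x \<noteq> 0" "d * quad B1 x + f * quad C1 x \<ge> 0"
      using no_descent[OF p(1) q(1)]
      by (auto simp: negative_definite_def quad_add quad_scaleR_matrix d_def f_def not_less)
    have "negative_definite (d *\<^sub>R B2 + f *\<^sub>R C2)"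
      unfolding negative_definite_def quad_add quad_scaleR_matrix
    proof (intro allI impI)
      fix y :: "real^'m" assume y: "y \<noteq> 0"
      have c: "quad C1 x < 0" "quad C2 y > 0"
        using C1 C2 x y by (auto simp: negative_definite_def positive_definite_def)
      have "d * (quad B1 x * quad C2 y) < d * (quad C1 x * quad B2 y)"
        using positive_definite_kronecker_diffD[OF delta x(1) y] d by simp
      moreover have "(d * quad B1 x + f * quad C1 x) * quad C2 y \<ge> 0"
        using x(2) c(2) by simp
      \<comment> \<open>The witness inequality, multiplied by the positive \<open>quad C2 y\<close>,
        is added to the Kronecker inequality scaled by \<open>d\<close>. Dividing by the negative
        \<open>quad C1 x\<close> then reverses the sign.\<close>
      ultimately have "quad C1 x * (d * quad B2 y + f * quad C2 y) > 0"
        by (simp add: algebra_simps)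
      then show "d * quad B2 y + f * quad C2 y < 0"
        using c(1) by (simp add: zero_less_mult_iff)
    qed
    with no_descent[OF p(2) q(2)] show False
      by (simp add: d_def f_def)
  qed
  have l: "l' = l"
    using not_less[OF pos pos'] not_less[OF pos' pos] by simp
  \<comment> \<open>With equal first coordinates the first matrix changes by a multiple of
    \<open>C1\<close>, so increasing the second coordinate decreases it strictly.\<close>
  have "\<not> mu < mu'"
    using no_descent[OF pos(1) pos'(1)] C1
    by (auto simp: l negative_definite_def quad_scaleR_matrix mult_pos_neg)
  moreover have "\<not> mu' < mu"
    using no_descent[OF pos'(1) pos(1)] C1
    by (auto simp: l negative_definite_def quad_scaleR_matrix mult_pos_neg)
  ultimately show ?thesis using l by simp
qed

section \<open>Fixed points of the alternating iteration\<close>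

theorem theorem8:
  fixes A1 B1 C1 :: "real^'n^'n" and A2 B2 C2 :: "real^'m^'m"
    and u :: "real^'n" and v :: "real^'m" and l mu :: real and i j :: nat
  assumes "symmetric A1" "symmetric B1" "symmetric C1"
    and "symmetric A2" "symmetric B2" "symmetric C2"
    and "positive_definite C2"
    and "positive_definite (C1 \<otimes>\<^sub>K B2 - B1 \<otimes>\<^sub>K C2)"
    and "negative_definite C1"
    and "i \<in> {1..CARD('n)}" "j \<in> {1..CARD('m)}"
    and "alternating_fixed_point A1 B1 C1 A2 B2 C2 i j u v l mu"
  shows "tpep_eigenvalue_index A1 B1 C1 A2 B2 C2 i j l mu \<and>
         (\<forall>l' mu'. tpep_eigenvalue_index A1 B1 C1 A2 B2 C2 i j l' mu' \<longrightarrow> l' = l \<and> mu' = mu) \<and>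
         tpep_eigenvector A1 B1 C1 A2 B2 C2 l mu (u \<otimes>\<^sub>V v) \<and>
         (A1 + l *\<^sub>R B1 + mu *\<^sub>R C1) *v u = 0 \<and>
         (A2 + l *\<^sub>R B2 + mu *\<^sub>R C2) *v v = 0"
proof -
  note sym = assms(1-6)
  have fp: "u \<noteq> 0" "v \<noteq> 0" and mu: "mu = - ((quad A2 v + l * quad B2 v) / quad C2 v)"
    using assms(12) by (auto simp: alternating_fixed_point_def Let_def)
  define M1 where "M1 = quad C2 v *\<^sub>R A1 - quad A2 v *\<^sub>R C1"
  define N1 where "N1 = quad B2 v *\<^sub>R C1 - quad C2 v *\<^sub>R B1"
  define M2 where "M2 = quad A1 u *\<^sub>R C2 - quad C1 u *\<^sub>R A2"
  define N2 where "N2 = quad C1 u *\<^sub>R B2 - quad B1 u *\<^sub>R C2"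
  define W1 where "W1 = A1 + l *\<^sub>R B1 + mu *\<^sub>R C1"
  define W2 where "W2 = A2 + l *\<^sub>R B2 + mu *\<^sub>R C2"
  obtain l' where eig1: "kth_smallest_gen_eigenvalue M1 N1 i l" "M1 *v u = l *\<^sub>R (N1 *v u)"
    and eig2: "kth_smallest_gen_eigenvalue M2 N2 j l'" "M2 *v v = l' *\<^sub>R (N2 *v v)"
    using assms(12)
    by (auto simp: alternating_fixed_point_def gen_eigenvector_def Let_def M1_def N1_def M2_def N2_def)
  have c: "quad C1 u < 0" "quad C2 v > 0"
    using assms(7,9) fp by (auto simp: negative_definite_def positive_definite_def)
  \<comment> \<open>Positivity of \<open>N1\<close> and \<open>N2\<close> is the Kronecker
    inequality with one of its two vectors frozen at \<open>v\<close> or \<open>u\<close>.\<close>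
  have pencil1: "symmetric_pencil M1 N1"
    using sym positive_definite_kronecker_diffD[OF assms(8) _ fp(2)]
    by unfold_locales (auto simp: M1_def N1_def positive_definite_def quad_diff quad_scaleR_matrix
        symmetric_diff symmetric_scaleR mult.commute)
  have pencil2: "symmetric_pencil M2 N2"
    using sym positive_definite_kronecker_diffD[OF assms(8) fp(1)]
    by unfold_locales (auto simp: M2_def N2_def positive_definite_def quad_diff quad_scaleR_matrix
        symmetric_diff symmetric_scaleR)
  \<comment> \<open>The formula for \<open>mu\<close> says that the second form vanishes at
    \<open>v\<close>; this turns the first pencil at \<open>l\<close> into a positive multiple of
    \<open>W1\<close>.\<close>
  have W1: "M1 - l *\<^sub>R N1 = quad C2 v *\<^sub>R W1"
  proof -
    have "quad C2 v * mu = - quad A2 v - l * quad B2 v"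
      using c(2) by (simp add: mu)
    then have "quad C2 v *\<^sub>R W1 =
        quad C2 v *\<^sub>R A1 + (quad C2 v * l) *\<^sub>R B1 + (- quad A2 v - l * quad B2 v) *\<^sub>R C1"
      by (simp add: W1_def scaleR_add_right)
    then show ?thesis
      by (simp add: M1_def N1_def algebra_simps)
  qed
  have "quad C2 v *\<^sub>R (W1 *v u) = (M1 - l *\<^sub>R N1) *v u"
    by (simp only: W1 matrix_vector_mult_scaleR_left)
  also have "\<dots> = 0"
    using eig1(2) by (simp add: matrix_vector_mult_diff_rdistrib matrix_vector_mult_scaleR_left)
  finally have u: "W1 *v u = 0"
    using c(2) by simp
  \<comment> \<open>Pairing the first equation with \<open>u\<close> expresses \<open>mu\<close>
    through the forms at \<open>u\<close>, as needed for the second pencil.\<close>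
  have quad1: "quad A1 u + l * quad B1 u + mu * quad C1 u = 0"
    using u quad_def[of W1 u] by (simp add: W1_def quad_add quad_scaleR_matrix)
  \<comment> \<open>Both eigenvalues are Rayleigh quotients at their eigenvectors. The two quotients
    have the same numerator and the same positive denominator.\<close>
  have "quad M1 u = l * quad N1 u" "quad M2 v = l' * quad N2 v"
    using eig1(2) eig2(2) by (simp_all add: quad_def)
  moreover have "quad M2 v = quad M1 u" "quad N2 v = quad N1 u"
    by (simp_all add: M1_def M2_def N1_def N2_def quad_diff quad_scaleR_matrix)
  moreover have "quad N1 u > 0"
    using pencil1 fp(1) by (rule symmetric_pencil.quad_N_pos)
  ultimately have l': "l' = l"
    by simp
  have W2: "M2 - l *\<^sub>R N2 = (- quad C1 u) *\<^sub>R W2"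
  proof -
    have A1: "quad A1 u = - (l * quad B1 u) - mu * quad C1 u"
      using quad1 by simp
    show ?thesis
      unfolding M2_def N2_def W2_def A1 by (simp add: algebra_simps)
  qed
  have "(- quad C1 u) *\<^sub>R (W2 *v v) = (M2 - l *\<^sub>R N2) *v v"
    by (simp only: W2 matrix_vector_mult_scaleR_left)
  also have "\<dots> = 0"
    using eig2(2) by (simp add: l' matrix_vector_mult_diff_rdistrib matrix_vector_mult_scaleR_left)
  finally have v: "W2 *v v = 0"
    using c(1) by simp
  have pos1: "zero_in_position W1 i"
    using eig1(1) c(2)
    by (simp add: symmetric_pencil.kth_smallest_iff_zero_in_position[OF pencil1] W1 zero_in_position_scaleR)
  have pos2: "zero_in_position W2 j"
    using eig2(1) c(1) zero_in_position_scaleR[of "- quad C1 u" W2 j]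
    by (simp add: symmetric_pencil.kth_smallest_iff_zero_in_position[OF pencil2] l' W2)
  \<comment> \<open>Stated for arbitrary pairs, so that it also applies to a competing eigenvalue of
    the same index.\<close>
  have index: "tpep_eigenvalue_index A1 B1 C1 A2 B2 C2 i j p q \<longleftrightarrow>
      tpep_eigenvalue A1 B1 C1 A2 B2 C2 p q \<and>
      zero_in_position (A1 + p *\<^sub>R B1 + q *\<^sub>R C1) i \<and> zero_in_position (A2 + p *\<^sub>R B2 + q *\<^sub>R C2) j" for p q
    using sym by (simp add: tpep_eigenvalue_index_def kth_smallest_eigenvalue_zero_iff symmetric_add symmetric_scaleR)
  have "tpep_eigenvalue_index A1 B1 C1 A2 B2 C2 i j l mu"
    using fp u v pos1 pos2 unfolding index tpep_eigenvalue_def W1_def W2_def by blast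
  moreover have "p = l \<and> q = mu" if "tpep_eigenvalue_index A1 B1 C1 A2 B2 C2 i j p q" for p q
    using tpep_index_unique[OF assms(7,9,8) pos1[unfolded W1_def] pos2[unfolded W2_def]] that index by blast
  moreover have "tpep_eigenvector A1 B1 C1 A2 B2 C2 l mu (u \<otimes>\<^sub>V v)"
    using fp u v unfolding tpep_eigenvector_def W1_def W2_def by blast
  ultimately show ?thesis
    using u v unfolding W1_def W2_def by blast
qed

end
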